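(* Let $n\ge3$, $\epsilon>0$ and let $K\ge1$ be an integer. Let $t_n=12\sqrt{\frac{\log n}{n}}$, $\widehat\epsilon=\sqrt{\epsilon^2+t_n}$, and consider the test of the null hypothesis $N^{(p)}_\Omega(\epsilon)\le K$ that accepts the null hypothesis if and only if $\widehat N^{(p.new)}_\Omega(\widehat\epsilon)\le K$. For any graphon, the type I error is at most $\frac2n$: that is, for every graphon $(\Omega,\mu,W)$ with $N^{(p)}_\Omega(\epsilon)\le K$, $$\mathbb{P}_{(\Omega,\mu,W)}\big[\widehat N^{(p.new)}_\Omega(\widehat\epsilon)>K\big]\le\frac2n .$$
   Context: A graphon is a triplet $(\Omega,\mu,W)$ where $\Omega$ is a measurable space, $\mu$ a probability measure on $\Omega$ and $W:\Omega\times\Omega\to[0,1]$ a symmetric measurable function. Neighborhood distance: $r_W(\omega,\omega')=\big(\int_\Omega |W(\omega,z)-W(\omega',z)|^2\mu(dz)\big)^{1/2}$. The packing number $N^{(p)}_\Omega(\epsilon)$ is the maximal number of points of $\Omega$ whose pairwise $r_W$-distances are all strictly larger than $\epsilon$. $W$-random graph model on $n$ nodes: $\omega_1,\dots,\omega_n$ are i.i.d. with law $\mu$ (unobserved); conditionally on them, the entries $A_{ij}$, $i<j$, are independent Bernoulli with parameters $W(\omega_i,\omega_j)$; $A_{ji}=A_{ij}$, $A_{ii}=0$. $\mathbb{P}_{(\Omega,\mu,W)}$ denotes the corresponding probability. Estimators: with $A_i$ the $i$-th row of $A$ and $\langle A_i,A_j\rangle_n=\frac1n\sum_{k=1}^n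 A_{ik}A_{jk}$, put $\widehat f(i,j)=\max_{k\ne i,j}|\langle A_k,A_i-A_j\rangle_n|$, $\widehat m(i)\in\operatorname{argmin}_{j\ne i}\widehat f(i,j)$ (ties broken arbitrarily), and $$\widehat r_{new}^{\,2}(i,j)=\Big[\langle A_i,A_{\widehat m(i)}\rangle_n+\langle A_j,A_{\widehat m(j)}\rangle_n-2\max_{k\in\{i,\widehat m(i)\},\,l\in\{j,\widehat m(j)\}}\langle A_k,A_l\rangle_n\Big]_+,$$ where $[a]_+=\max(a,0)$, and $\widehat r_{new}$ is its square root. $\widehat N^{(p.new)}_\Omega(\epsilon)$ is the maximal size of a subset of $[n]$ whose distinct elements $i,j$ all satisfy $\widehat r_{new}(i,j)>\epsilon$. *)

theory Defs
  imports "HOL-Probability.Probability" "HOL-Library.Extended_Nat"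
begin

locale graphon = prob_space M for M :: "'a measure" +
  fixes W :: "'a \<Rightarrow> 'a \<Rightarrow> real"
  assumes W_measurable: "case_prod W \<in> borel_measurable (M \<Otimes>\<^sub>M M)"
    and W_symmetric: "\<And>x y. x \<in> space M \<Longrightarrow> y \<in> space M \<Longrightarrow> W x y = W y x"
    and W_range: "\<And>x y. x \<in> space M \<Longrightarrow> y \<in> space M \<Longrightarrow> W x y \<in> {0..1}"

definition nbhd_dist :: "'a measure \<Rightarrow> ('a \<Rightarrow> 'a \<Rightarrow> real) \<Rightarrow> 'a \<Rightarrow> 'a \<Rightarrow> real" where
  "nbhd_dist M W x y = sqrt (\<integral>z. \<bar>W x z - W y z\<bar>\<^sup>2 \<partial>M)"

text \<open>The packing number is extended-natural valued because arbitrarily large finite packings may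
  exist. The function \<open>d\<close> need not be a metric.\<close>

definition packing_number :: "'b set \<Rightarrow> ('b \<Rightarrow> 'b \<Rightarrow> real) \<Rightarrow> real \<Rightarrow> enat" where
  "packing_number X d \<epsilon> =
     (SUP S \<in> {S. finite S \<and> S \<subseteq> X \<and> pairwise (\<lambda>x y. d x y > \<epsilon>) S}. enat (card S))"

definition edge_slots :: "nat \<Rightarrow> (nat \<times> nat) set" where
  "edge_slots n = {(i, j). 1 \<le> i \<and> i < j \<and> j \<le> n}"

definition adj_matrix :: "(nat \<times> nat \<Rightarrow> bool) \<Rightarrow> nat \<Rightarrow> nat \<Rightarrow> real" where
  "adj_matrix e i j = (if i < j then of_bool (e (i, j)) else if j < i then of_bool (e (j, i)) else 0)"

definition cond_graph_pmf ::
    "('a \<Rightarrow> 'a \<Rightarrow> real) \<Rightarrow> nat \<Rightarrow> (nat \<Rightarrow> 'a) \<Rightarrow> (nat \<Rightarrow> nat \<Rightarrow> real) pmf" where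
  "cond_graph_pmf W n \<omega> =
     map_pmf adj_matrix (Pi_pmf (edge_slots n) False (\<lambda>(i, j). bernoulli_pmf (W (\<omega> i) (\<omega> j))))"

text \<open>The law of the adjacency matrix (nodes are \<open>{1..n}\<close>): the latent positions are drawn from the
  product measure, then integrated out. Every set of matrices is an event.\<close>

definition W_random_graph ::
    "'a measure \<Rightarrow> ('a \<Rightarrow> 'a \<Rightarrow> real) \<Rightarrow> nat \<Rightarrow> (nat \<Rightarrow> nat \<Rightarrow> real) measure" where
  "W_random_graph M W n =
     (\<Pi>\<^sub>M i\<in>{1..n}. M) \<bind> (\<lambda>\<omega>. measure_pmf (cond_graph_pmf W n \<omega>))"

definition row_inner :: "nat \<Rightarrow> (nat \<Rightarrow> real) \<Rightarrow> (nat \<Rightarrow> real) \<Rightarrow> real" where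
  "row_inner n u v = (\<Sum>k=1..n. u k * v k) / real n"

definition f_hat :: "nat \<Rightarrow> (nat \<Rightarrow> nat \<Rightarrow> real) \<Rightarrow> nat \<Rightarrow> nat \<Rightarrow> real" where
  "f_hat n A i j = Max ((\<lambda>k. \<bar>row_inner n (A k) (\<lambda>z. A i z - A j z)\<bar>) ` ({1..n} - {i, j}))"

text \<open>A tie-breaking rule for the minimizer \<open>m A i\<close>; it may depend on the whole matrix.\<close>

definition argmin_rule :: "nat \<Rightarrow> ((nat \<Rightarrow> nat \<Rightarrow> real) \<Rightarrow> nat \<Rightarrow> nat) \<Rightarrow> bool" where
  "argmin_rule n m \<longleftrightarrow>
     (\<forall>A. \<forall>i\<in>{1..n}. is_arg_min (f_hat n A i) (\<lambda>j. j \<in> {1..n} - {i}) (m A i))"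

definition r_new :: "nat \<Rightarrow> ((nat \<Rightarrow> nat \<Rightarrow> real) \<Rightarrow> nat \<Rightarrow> nat) \<Rightarrow> (nat \<Rightarrow> nat \<Rightarrow> real) \<Rightarrow> nat \<Rightarrow> nat \<Rightarrow> real"
  where
  "r_new n m A i j =
     sqrt (max 0 (row_inner n (A i) (A (m A i)) + row_inner n (A j) (A (m A j))
       - 2 * Max ((\<lambda>(k, l). row_inner n (A k) (A l)) ` ({i, m A i} \<times> {j, m A j}))))"

definition N_hat_new ::
    "nat \<Rightarrow> ((nat \<Rightarrow> nat \<Rightarrow> real) \<Rightarrow> nat \<Rightarrow> nat) \<Rightarrow> (nat \<Rightarrow> nat \<Rightarrow> real) \<Rightarrow> real \<Rightarrow> enat" where
  "N_hat_new n m A \<epsilon> = packing_number {1..n} (r_new n m A) \<epsilon>"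

lemma finite_edge_slots: "finite (edge_slots n)"
  by (rule finite_subset[of _ "{1..n} \<times> {1..n}"]) (auto simp: edge_slots_def)

text \<open>The conditional law is a measurable kernel, so the monadic bind above is not degenerate.\<close>

context graphon
begin

lemma measurable_W_component [measurable]:
  assumes "i \<in> I" "j \<in> I"
  shows "(\<lambda>\<omega>. W (\<omega> i) (\<omega> j)) \<in> borel_measurable (\<Pi>\<^sub>M i\<in>I. M)"
proof -
  have "(\<lambda>\<omega>. (\<omega> i, \<omega> j)) \<in> (\<Pi>\<^sub>M i\<in>I. M) \<rightarrow>\<^sub>M (M \<Otimes>\<^sub>M M)"
    using assms by (intro measurable_Pair measurable_component_singleton) auto
  from measurable_compose[OF this W_measurable] show ?thesis by simp
qed

lemma measurable_cond_graph_pmf: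
  "(\<lambda>\<omega>. measure_pmf (cond_graph_pmf W n \<omega>))
     \<in> (\<Pi>\<^sub>M i\<in>{1..n}. M) \<rightarrow>\<^sub>M subprob_algebra (count_space UNIV)"
proof (rule measurable_subprob_algebra)
  fix \<omega> show "subprob_space (measure_pmf (cond_graph_pmf W n \<omega>))"
    by (rule measure_pmf.subprob_space_axioms)
next
  fix B :: "(nat \<Rightarrow> nat \<Rightarrow> real) set"
  let ?P = "\<Pi>\<^sub>M i\<in>{1..n}. M"
  let ?Q = "\<lambda>\<omega>. Pi_pmf (edge_slots n) False (\<lambda>(i, j). bernoulli_pmf (W (\<omega> i) (\<omega> j)))"
  let ?S = "PiE_dflt (edge_slots n) False (\<lambda>_. UNIV)"
  have fin: "finite ?S"
    by (intro finite_PiE_dflt) (auto simp: finite_edge_slots)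
  have supp: "set_pmf (?Q \<omega>) \<subseteq> ?S" for \<omega>
    using set_Pi_pmf_subset[OF finite_edge_slots, of n False] by (auto simp: PiE_dflt_def)
  have eq: "emeasure (measure_pmf (cond_graph_pmf W n \<omega>)) B
      = (\<Sum>e\<in>adj_matrix -` B \<inter> ?S. ennreal (\<Prod>(i, j)\<in>edge_slots n.
           if e (i, j) then W (\<omega> i) (\<omega> j) else 1 - W (\<omega> i) (\<omega> j)))"
    if \<omega>: "\<omega> \<in> space ?P" for \<omega>
  proof -
    have rng: "0 \<le> W (\<omega> i) (\<omega> j) \<and> W (\<omega> i) (\<omega> j) \<le> 1" if "(i, j) \<in> edge_slots n" for i j
      using W_range[of "\<omega> i" "\<omega> j"] \<omega> that by (auto simp: space_PiM edge_slots_def PiE_iff)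
    have "emeasure (measure_pmf (cond_graph_pmf W n \<omega>)) B
        = emeasure (measure_pmf (?Q \<omega>)) (adj_matrix -` B)"
      by (simp add: cond_graph_pmf_def)
    also have "\<dots> = emeasure (measure_pmf (?Q \<omega>)) (adj_matrix -` B \<inter> ?S)"
      using supp[of \<omega>] by (intro emeasure_eq_AE) (auto simp: AE_measure_pmf_iff)
    also have "\<dots> = (\<Sum>e\<in>adj_matrix -` B \<inter> ?S. ennreal (pmf (?Q \<omega>) e))"
      using fin by (subst emeasure_measure_pmf_finite) auto
    also have "\<dots> = (\<Sum>e\<in>adj_matrix -` B \<inter> ?S. ennreal (\<Prod>(i, j)\<in>edge_slots n.
           if e (i, j) then W (\<omega> i) (\<omega> j) else 1 - W (\<omega> i) (\<omega> j)))"
    proof (intro sum.cong refl arg_cong[where f = ennreal])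
      fix e assume e: "e \<in> adj_matrix -` B \<inter> ?S"
      have "pmf (?Q \<omega>) e = (\<Prod>x\<in>edge_slots n. pmf (case x of (i, j) \<Rightarrow> bernoulli_pmf (W (\<omega> i) (\<omega> j))) (e x))"
        using e by (subst pmf_Pi[OF finite_edge_slots]) (auto simp: PiE_dflt_def)
      also have "\<dots> = (\<Prod>(i, j)\<in>edge_slots n.
           if e (i, j) then W (\<omega> i) (\<omega> j) else 1 - W (\<omega> i) (\<omega> j))"
        using rng by (intro prod.cong) auto
      finally show "pmf (?Q \<omega>) e = \<dots>" .
    qed
    finally show ?thesis .
  qed
  have "(\<lambda>\<omega>. \<Sum>e\<in>adj_matrix -` B \<inter> ?S. ennreal (\<Prod>(i, j)\<in>edge_slots n.
           if e (i, j) then W (\<omega> i) (\<omega> j) else 1 - W (\<omega> i) (\<omega> j))) \<in> borel_measurable ?P"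
  proof (intro borel_measurable_sum measurable_compose[OF _ measurable_ennreal] borel_measurable_prod)
    fix e x assume x: "x \<in> edge_slots n"
    obtain i j where ij: "x = (i, j)" by force
    have W: "(\<lambda>\<omega>. W (\<omega> i) (\<omega> j)) \<in> borel_measurable ?P"
      using x ij by (intro measurable_W_component) (auto simp: edge_slots_def)
    show "(\<lambda>\<omega>. case x of (i, j) \<Rightarrow> if e (i, j) then W (\<omega> i) (\<omega> j) else 1 - W (\<omega> i) (\<omega> j))
        \<in> borel_measurable ?P"
      unfolding ij using W borel_measurable_diff[OF borel_measurable_const W, of 1]
      by (cases "e (i, j)") simp_all
  qed
  then show "(\<lambda>\<omega>. emeasure (measure_pmf (cond_graph_pmf W n \<omega>)) B) \<in> borel_measurable ?P"
    by (subst measurable_cong[OF eq]) auto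
qed auto

lemma prob_space_W_random_graph: "prob_space (W_random_graph M W n)"
proof -
  interpret P: prob_space "\<Pi>\<^sub>M i\<in>{1..n}. M"
    by (intro prob_space_PiM prob_space_axioms)
  show ?thesis
    unfolding W_random_graph_def
    by (rule P.prob_space_bind[OF _ measurable_cond_graph_pmf])
       (auto intro: measure_pmf.prob_space_axioms)
qed

lemma sets_W_random_graph: "sets (W_random_graph M W n) = UNIV"
proof -
  interpret P: prob_space "\<Pi>\<^sub>M i\<in>{1..n}. M"
    by (intro prob_space_PiM prob_space_axioms)
  show ?thesis
    unfolding W_random_graph_def
    by (subst sets_bind[OF sets_kernel[OF measurable_cond_graph_pmf] P.not_empty]) auto
qed

end

end

theory Submission
  imports Defs
begin

text \<open>
  Write \<open>c x y\<close> for the \<open>L\<^sup>2\<close> inner product of \<open>W x\<close> and \<open>W y\<close>. With high probability every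
  \<open>row_inner n (A i) (A j)\<close> with \<open>i \<noteq> j\<close> is close to \<open>c (\<omega> i) (\<omega> j)\<close>. Given a packing \<open>S\<close> for the
  estimated distance, replace each \<open>i \<in> S\<close> by whichever of \<open>i\<close> and \<open>m A i\<close> has the neighbourhood
  function of larger norm; call it \<open>q i\<close>. Then \<open>c (\<omega> (q i)) (\<omega> (q i))\<close> dominates
  \<open>c (\<omega> i) (\<omega> (m A i))\<close>, so the squared
  neighbourhood distance of \<open>\<omega> (q i)\<close> and \<open>\<omega> (q j)\<close> is at least the estimated one up to the noise, and
  \<open>\<omega> \<circ> q\<close> maps \<open>S\<close> onto a true packing of the same size.

  The concentration is Hoeffding's argument applied to the common neighbour counts: the moment
  generating function is computed first over the edges, which are independent given the positions,
  and then over the positions other than \<open>\<omega> i\<close> and \<open>\<omega> j\<close>.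
\<close>

section \<open>Moment generating functions over independent edges\<close>

text \<open>Hoeffding's bound for a Bernoulli variable. For \<open>l < 0\<close>, exchanging success
  and failure replaces \<open>l\<close> by \<open>- l\<close> and \<open>p\<close> by
  \<open>1 - p\<close>, which leads back to a nonnegative exponent.\<close>

lemma bernoulli_mgf_le:
  fixes p l :: real
  assumes "0 \<le> p" "p \<le> 1"
  shows "1 + (exp l - 1) * p \<le> exp (l * p + l\<^sup>2 / 8)"
proof -
  have pos: "1 + h * q \<le> exp (l * q + l\<^sup>2 / 8)"
    if l: "0 \<le> l" and q: "0 \<le> q" and h: "h = exp l - 1" for l q h :: real
  proof -
    have "0 \<le> q * (exp l - 1)" using l q by simp
    hence "0 < 1 + q * (exp l - 1)" by simp
    moreover have "ln (1 + q * (exp l - 1)) \<le> l * q + l\<^sup>2 / 8"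
      using Hoeffdings_lemma_aux[OF l q] by simp
    ultimately show ?thesis by (metis exp_le_cancel_iff exp_ln h mult.commute)
  qed
  show ?thesis
  proof (cases "0 \<le> l")
    case True
    then show ?thesis using pos assms by simp
  next
    case False
    have "1 + (exp l - 1) * p = exp l * (1 + (exp (- l) - 1) * (1 - p))"
      by (simp add: algebra_simps exp_minus)
    also have "\<dots> \<le> exp l * exp (- l * (1 - p) + (- l)\<^sup>2 / 8)"
      using False assms by (intro mult_left_mono pos) auto
    also have "\<dots> = exp (l * p + l\<^sup>2 / 8)"
      by (simp add: algebra_simps flip: exp_add)
    finally show ?thesis .
  qed
qed

lemma expectation_Pi_pmf_two:
  fixes p :: "'i \<Rightarrow> bool pmf"
  assumes "finite I" "{a, b} \<subseteq> I" "a \<noteq> b"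
  shows "measure_pmf.expectation (Pi_pmf I d p) (\<lambda>e. of_bool (e a) * of_bool (e b) :: real) =
    pmf (p a) True * pmf (p b) True"
proof -
  have "measure_pmf.expectation (Pi_pmf I d p) (\<lambda>e. of_bool (e a) * of_bool (e b) :: real) =
      measure_pmf.expectation (Pi_pmf {a, b} d p) (\<lambda>e. \<Prod>x\<in>{a, b}. of_bool (e x))"
    using assms by (subst Pi_pmf_subset[OF assms(1,2)]) simp
  also have "\<dots> = (\<Prod>x\<in>{a, b}. measure_pmf.expectation (p x) of_bool)"
    by (rule expectation_prod_Pi_pmf) (auto intro: integrable_measure_pmf_finite)
  also have "\<dots> = pmf (p a) True * pmf (p b) True"
    using assms(3) by (simp add: integral_measure_pmf_real[where A = UNIV] UNIV_bool)
  finally show ?thesis .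
qed

text \<open>The pairs of coordinates are disjoint, so the conjunctions are independent Bernoulli
  variables and the expectation of the product of exponentials factorizes.\<close>

lemma nn_integral_Pi_pmf_exp_conj:
  fixes p :: "'i \<Rightarrow> bool pmf" and s t :: "'k \<Rightarrow> 'i" and l :: real
  assumes I: "finite I" and J: "finite J"
    and sub: "\<And>k. k \<in> J \<Longrightarrow> {s k, t k} \<subseteq> I" and neq: "\<And>k. k \<in> J \<Longrightarrow> s k \<noteq> t k"
    and disj: "disjoint_family_on (\<lambda>k. {s k, t k}) J"
  shows "(\<integral>\<^sup>+ e. ennreal (exp (l * (\<Sum>k\<in>J. of_bool (e (s k) \<and> e (t k))))) \<partial>Pi_pmf I d p) =
    (\<Prod>k\<in>J. ennreal (1 + (exp l - 1) * (pmf (p (s k)) True * pmf (p (t k)) True)))"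
proof -
  let ?Q = "Pi_pmf I d p"
  let ?Y = "\<lambda>k f. ennreal (exp (l * of_bool (f (s k) \<and> f (t k))))"
  have "prob_space.indep_vars ?Q (\<lambda>k. PiM {s k, t k} (\<lambda>_. count_space UNIV))
      (\<lambda>k e. restrict (\<lambda>x. e x) {s k, t k}) J"
    by (rule prob_space.indep_vars_restrict[OF measure_pmf.prob_space_axioms indep_vars_Pi_pmf[OF I] sub disj])
  hence "prob_space.indep_vars ?Q (\<lambda>_. borel) (\<lambda>k e. ?Y k (restrict (\<lambda>x. e x) {s k, t k})) J"
  proof (rule prob_space.indep_vars_compose2[OF measure_pmf.prob_space_axioms])
    fix k
    have "(\<lambda>f. f x) \<in> PiM {s k, t k} (\<lambda>_. count_space UNIV) \<rightarrow>\<^sub>M count_space (UNIV :: bool set)"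
      if "x \<in> {s k, t k}" for x
      using that by (rule measurable_component_singleton)
    from this[of "s k"] this[of "t k"]
    have [measurable]: "Measurable.pred (PiM {s k, t k} (\<lambda>_. count_space UNIV)) (\<lambda>f. f (s k))"
      "Measurable.pred (PiM {s k, t k} (\<lambda>_. count_space UNIV)) (\<lambda>f. f (t k))"
      by auto
    show "?Y k \<in> borel_measurable (PiM {s k, t k} (\<lambda>_. count_space UNIV))"
      by measurable
  qed
  hence indep: "prob_space.indep_vars ?Q (\<lambda>_. borel) ?Y J"
    by simp
  have factor: "(\<integral>\<^sup>+ e. ?Y k e \<partial>?Q) =
      ennreal (1 + (exp l - 1) * (pmf (p (s k)) True * pmf (p (t k)) True))" if k: "k \<in> J" for k
  proof -
    have int: "integrable ?Q (\<lambda>e. of_bool (e (s k)) * of_bool (e (t k)) :: real)"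
      by (rule measure_pmf.integrable_const_bound[where B = 1]) auto
    \<comment> \<open>The exponential of a 0-1 quantity is affine in it, which reduces the factor to
      a product of two success probabilities.\<close>
    have exp_eq: "exp (l * of_bool (e (s k) \<and> e (t k)))
        = 1 + (exp l - 1) * (of_bool (e (s k)) * of_bool (e (t k)))" for e :: "'i \<Rightarrow> bool"
      by simp
    have int': "integrable ?Q (\<lambda>e. exp (l * of_bool (e (s k) \<and> e (t k))))"
      unfolding exp_eq using int by simp
    have "(\<integral>\<^sup>+ e. ?Y k e \<partial>?Q)
        = ennreal (measure_pmf.expectation ?Q (\<lambda>e. exp (l * of_bool (e (s k) \<and> e (t k)))))"
      by (rule nn_integral_eq_integral[OF int']) simp
    also have "measure_pmf.expectation ?Q (\<lambda>e. exp (l * of_bool (e (s k) \<and> e (t k))))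
        = 1 + (exp l - 1) * (pmf (p (s k)) True * pmf (p (t k)) True)"
      unfolding exp_eq using int expectation_Pi_pmf_two[OF I sub[OF k] neq[OF k]] by simp
    finally show ?thesis .
  qed
  have "(\<integral>\<^sup>+ e. ennreal (exp (l * (\<Sum>k\<in>J. of_bool (e (s k) \<and> e (t k))))) \<partial>?Q)
      = (\<integral>\<^sup>+ e. (\<Prod>k\<in>J. ?Y k e) \<partial>?Q)"
    by (simp only: sum_distrib_left exp_sum[OF J] prod_ennreal exp_ge_zero)
  also have "\<dots> = (\<Prod>k\<in>J. \<integral>\<^sup>+ e. ?Y k e \<partial>?Q)"
    by (rule prob_space.indep_vars_nn_integral[OF measure_pmf.prob_space_axioms J indep]) simp
  also have "\<dots> = (\<Prod>k\<in>J. ennreal (1 + (exp l - 1) * (pmf (p (s k)) True * pmf (p (t k)) True)))"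
    by (intro prod.cong refl factor)
  finally show ?thesis .
qed

section \<open>Neighbourhood inner products and common neighbour counts\<close>

definition nbhd_inner :: "'a measure \<Rightarrow> ('a \<Rightarrow> 'a \<Rightarrow> real) \<Rightarrow> 'a \<Rightarrow> 'a \<Rightarrow> real" where
  "nbhd_inner M W x y = (\<integral>z. W x z * W y z \<partial>M)"

text \<open>Each edge is stored once, under its smaller endpoint first; this is the key of the
  unordered pair of \<open>i\<close> and \<open>k\<close>.\<close>

definition slot :: "nat \<Rightarrow> nat \<Rightarrow> nat \<times> nat" where
  "slot i k = (min i k, max i k)"

lemma adj_matrix_slot: "i \<noteq> k \<Longrightarrow> adj_matrix e i k = of_bool (e (slot i k))"
  by (auto simp: adj_matrix_def slot_def)

lemma slot_in_edge_slots: "i \<in> {1..n} \<Longrightarrow> k \<in> {1..n} \<Longrightarrow> i \<noteq> k \<Longrightarrow> slot i k \<in> edge_slots n"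
  by (auto simp: edge_slots_def slot_def min_def max_def)

lemma slot_eq_iff: "slot i k = slot j l \<longleftrightarrow> i = j \<and> k = l \<or> i = l \<and> k = j"
  by (auto simp: slot_def min_def max_def split: if_splits)

text \<open>The terms \<open>k = i\<close> and \<open>k = j\<close> vanish because the diagonal is
  zero. For two nodes this leaves \<open>n - 2\<close> summands, still divided by
  \<open>n\<close>.\<close>

lemma row_inner_adj_matrix:
  assumes "i \<noteq> j"
  shows "row_inner n (adj_matrix e i) (adj_matrix e j) =
    (\<Sum>k\<in>{1..n} - {i, j}. of_bool (e (slot i k) \<and> e (slot j k))) / real n"
proof -
  have "(\<Sum>k = 1..n. adj_matrix e i k * adj_matrix e j k)
      = (\<Sum>k\<in>{1..n} - {i, j}. adj_matrix e i k * adj_matrix e j k)"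
    by (rule sum.mono_neutral_right) (auto simp: adj_matrix_def)
  also have "\<dots> = (\<Sum>k\<in>{1..n} - {i, j}. of_bool (e (slot i k) \<and> e (slot j k)))"
    by (intro sum.cong refl) (auto simp: adj_matrix_slot)
  finally show ?thesis by (simp add: row_inner_def)
qed

text \<open>The entries are 0 or 1, so a product of two entries is at most the square of
  either.\<close>

lemma row_inner_adj_matrix_le_self:
  "row_inner n (adj_matrix e i) (adj_matrix e j) \<le> row_inner n (adj_matrix e i) (adj_matrix e i)"
  "row_inner n (adj_matrix e j) (adj_matrix e i) \<le> row_inner n (adj_matrix e i) (adj_matrix e i)"
  unfolding row_inner_def
  by (intro divide_right_mono sum_mono; simp add: adj_matrix_def)+

text \<open>For distinct nodes \<open>i\<close> and \<open>j\<close>, this is the conditional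
  expectation, given the positions, of the exponential of \<open>l\<close> times the common
  neighbour count minus \<open>n - 2\<close> times its limit \<open>nbhd_inner\<close>. The centring
  is spread over the factors so that each \<open>k\<close> can be integrated separately.\<close>

definition centered_mgf ::
    "'a measure \<Rightarrow> ('a \<Rightarrow> 'a \<Rightarrow> real) \<Rightarrow> nat \<Rightarrow> real \<Rightarrow> nat \<Rightarrow> nat \<Rightarrow> (nat \<Rightarrow> 'a) \<Rightarrow> ennreal" where
  "centered_mgf M W n l i j \<omega> =
     (\<Prod>k\<in>{1..n} - {i, j}. ennreal (1 + (exp l - 1) * (W (\<omega> i) (\<omega> k) * W (\<omega> j) (\<omega> k)))
        * ennreal (exp (- (l * nbhd_inner M W (\<omega> i) (\<omega> j)))))"

section \<open>Geometry of the neighbourhood functions\<close>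

context graphon
begin

lemma measurable_W_section [measurable]:
  "x \<in> space M \<Longrightarrow> W x \<in> borel_measurable M"
  using measurable_compose[OF measurable_Pair1' W_measurable, of x] by simp

lemma integrable_W_product:
  assumes "x \<in> space M" "y \<in> space M"
  shows "integrable M (\<lambda>z. W x z * W y z)"
proof (rule integrable_const_bound[where B = 1])
  show "AE z in M. norm (W x z * W y z) \<le> 1"
  proof (rule AE_I2)
    fix z assume "z \<in> space M"
    then show "norm (W x z * W y z) \<le> 1"
      using W_range[of x z] W_range[of y z] assms by (simp add: abs_mult mult_le_one)
  qed
qed (use assms in measurable)

lemma nbhd_inner_range:
  assumes "x \<in> space M" "y \<in> space M"
  shows "0 \<le> nbhd_inner M W x y" "nbhd_inner M W x y \<le> 1"
proof -
  have W: "0 \<le> W x z * W y z \<and> W x z * W y z \<le> 1" if "z \<in> space M" for z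
    using W_range[of x z] W_range[of y z] assms that by (simp add: mult_le_one)
  show "0 \<le> nbhd_inner M W x y"
    unfolding nbhd_inner_def by (rule integral_nonneg_AE) (use W in auto)
  have "nbhd_inner M W x y \<le> (\<integral>z. 1 \<partial>M)"
    unfolding nbhd_inner_def using W integrable_W_product[OF assms] by (intro integral_mono) auto
  then show "nbhd_inner M W x y \<le> 1" by (simp add: prob_space)
qed

lemma nbhd_dist_squared:
  assumes "x \<in> space M" "y \<in> space M"
  shows "(nbhd_dist M W x y)\<^sup>2 =
    nbhd_inner M W x x + nbhd_inner M W y y - 2 * nbhd_inner M W x y"
proof -
  have "(nbhd_dist M W x y)\<^sup>2 = (\<integral>z. \<bar>W x z - W y z\<bar>\<^sup>2 \<partial>M)"
    by (simp add: nbhd_dist_def)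
  also have "\<dots> = (\<integral>z. W x z * W x z + W y z * W y z - 2 * (W x z * W y z) \<partial>M)"
    by (simp add: power2_eq_square algebra_simps)
  also have "\<dots> = nbhd_inner M W x x + nbhd_inner M W y y - 2 * nbhd_inner M W x y"
    unfolding nbhd_inner_def using integrable_W_product assms by simp
  finally show ?thesis .
qed

text \<open>A squared distance is nonnegative, so twice the mixed inner product is at most the sum
  of the two squared norms.\<close>

lemma nbhd_inner_le_max:
  assumes "x \<in> space M" "y \<in> space M"
  shows "nbhd_inner M W x y \<le> max (nbhd_inner M W x x) (nbhd_inner M W y y)"
  using nbhd_dist_squared[OF assms] zero_le_power2[of "nbhd_dist M W x y"] by linarith

section \<open>Concentration of the row inner products\<close>

lemma measurable_centered_mgf [measurable]:
  assumes "i \<in> {1..n}" "j \<in> {1..n}"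
  shows "centered_mgf M W n l i j \<in> borel_measurable (\<Pi>\<^sub>M i\<in>{1..n}. M)"
proof -
  have meas_inner: "(\<lambda>\<omega>. nbhd_inner M W (\<omega> i) (\<omega> j)) \<in> borel_measurable (\<Pi>\<^sub>M i\<in>{1..n}. M)"
    unfolding nbhd_inner_def
  proof (rule borel_measurable_lebesgue_integral)
    have "(\<lambda>p. (fst p i, snd p)) \<in> (\<Pi>\<^sub>M i\<in>{1..n}. M) \<Otimes>\<^sub>M M \<rightarrow>\<^sub>M M \<Otimes>\<^sub>M M"
         "(\<lambda>p. (fst p j, snd p)) \<in> (\<Pi>\<^sub>M i\<in>{1..n}. M) \<Otimes>\<^sub>M M \<rightarrow>\<^sub>M M \<Otimes>\<^sub>M M"
      using assms by measurable
    from this[THEN measurable_compose[OF _ W_measurable]]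
    show "(\<lambda>(\<omega>, z). W (\<omega> i) z * W (\<omega> j) z) \<in> borel_measurable ((\<Pi>\<^sub>M i\<in>{1..n}. M) \<Otimes>\<^sub>M M)"
      by (simp add: split_beta)
  qed
  note [measurable] = meas_inner
  show ?thesis
    unfolding centered_mgf_def
  proof (rule borel_measurable_prod_ennreal)
    fix k assume "k \<in> {1..n} - {i, j}"
    then have [measurable]: "(\<lambda>\<omega>. W (\<omega> i) (\<omega> k)) \<in> borel_measurable (\<Pi>\<^sub>M i\<in>{1..n}. M)"
      "(\<lambda>\<omega>. W (\<omega> j) (\<omega> k)) \<in> borel_measurable (\<Pi>\<^sub>M i\<in>{1..n}. M)"
      using assms by (auto intro!: measurable_W_component)
    show "(\<lambda>\<omega>. ennreal (1 + (exp l - 1) * (W (\<omega> i) (\<omega> k) * W (\<omega> j) (\<omega> k)))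
        * ennreal (exp (- (l * nbhd_inner M W (\<omega> i) (\<omega> j)))))
      \<in> borel_measurable (\<Pi>\<^sub>M i\<in>{1..n}. M)"
      by measurable
  qed
qed

text \<open>With \<open>\<omega> i\<close> and \<open>\<omega> j\<close> fixed, the other positions
  are independent and the integral of the product splits. Each factor is a centred Bernoulli moment
  generating function with mean \<open>nbhd_inner\<close>, and Hoeffding's bound for it does not
  depend on \<open>\<omega> i\<close> and \<open>\<omega> j\<close>.\<close>

lemma nn_integral_centered_mgf_le:
  assumes "i \<in> {1..n}" "j \<in> {1..n}" "i \<noteq> j"
  shows "(\<integral>\<^sup>+ \<omega>. centered_mgf M W n l i j \<omega> \<partial>(\<Pi>\<^sub>M i\<in>{1..n}. M))
    \<le> ennreal (exp (real (n - 2) * (l\<^sup>2 / 8)))"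
proof -
  define J where "J = {1..n} - {i, j}"
  interpret product_sigma_finite "\<lambda>_. M" by standard
  let ?h = "\<lambda>x y z. ennreal (1 + (exp l - 1) * (W x z * W y z)) * ennreal (exp (- (l * nbhd_inner M W x y)))"
  let ?f = "\<lambda>\<omega>. \<Prod>k\<in>J. ?h (\<omega> i) (\<omega> j) (\<omega> k)"
  have f: "?f = centered_mgf M W n l i j"
    by (simp add: fun_eq_iff centered_mgf_def J_def)
  have I: "{i, j} \<union> J = {1..n}" "{i, j} \<inter> J = {}" "finite J"
    using assms(1,2) by (auto simp: J_def)
  have h: "(\<integral>\<^sup>+ z. ?h x y z \<partial>M) \<le> ennreal (exp (l\<^sup>2 / 8))" if xy: "x \<in> space M" "y \<in> space M" for x y
  proof -
    have [measurable]: "W x \<in> borel_measurable M" "W y \<in> borel_measurable M"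
      using xy by auto
    have int: "integrable M (\<lambda>z. 1 + (exp l - 1) * (W x z * W y z))"
      using integrable_W_product[OF xy] by simp
    have nonneg: "0 \<le> 1 + (exp l - 1) * (W x z * W y z)" if "z \<in> space M" for z
    proof -
      have p: "0 \<le> W x z * W y z" "W x z * W y z \<le> 1"
        using W_range[of x z] W_range[of y z] xy that by (auto simp: mult_le_one)
      \<comment> \<open>For negative \<open>l\<close> the coefficient \<open>exp l - 1\<close> is
        negative; the convex combination of 1 and \<open>exp l\<close> shows the sign.\<close>
      have "1 + (exp l - 1) * (W x z * W y z) = (1 - W x z * W y z) + exp l * (W x z * W y z)"
        by (simp add: algebra_simps)
      also have "\<dots> \<ge> 0"
        using p by (intro add_nonneg_nonneg mult_nonneg_nonneg[of "exp l"]) auto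
      finally show ?thesis .
    qed
    have "(\<integral>\<^sup>+ z. ennreal (1 + (exp l - 1) * (W x z * W y z)) \<partial>M)
        = ennreal (\<integral>z. 1 + (exp l - 1) * (W x z * W y z) \<partial>M)"
      using nonneg by (intro nn_integral_eq_integral int AE_I2)
    also have "(\<integral>z. 1 + (exp l - 1) * (W x z * W y z) \<partial>M) = 1 + (exp l - 1) * nbhd_inner M W x y"
      using integrable_W_product[OF xy] by (simp add: nbhd_inner_def prob_space)
    finally have "(\<integral>\<^sup>+ z. ?h x y z \<partial>M)
        = ennreal (1 + (exp l - 1) * nbhd_inner M W x y) * ennreal (exp (- (l * nbhd_inner M W x y)))"
      by (simp add: nn_integral_multc)
    also have "\<dots> \<le> ennreal (exp (l * nbhd_inner M W x y + l\<^sup>2 / 8))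
        * ennreal (exp (- (l * nbhd_inner M W x y)))"
      using nbhd_inner_range[OF xy] by (intro mult_right_mono ennreal_leI bernoulli_mgf_le) auto
    also have "\<dots> = ennreal (exp (l\<^sup>2 / 8))"
      by (simp flip: ennreal_mult exp_add)
    finally show ?thesis .
  qed
  have "(\<integral>\<^sup>+ \<omega>. ?f \<omega> \<partial>(\<Pi>\<^sub>M i\<in>{1..n}. M))
      = (\<integral>\<^sup>+ x. (\<integral>\<^sup>+ y. ?f (merge {i, j} J (x, y)) \<partial>(\<Pi>\<^sub>M i\<in>J. M)) \<partial>(\<Pi>\<^sub>M i\<in>{i, j}. M))"
    using product_nn_integral_fold[of "{i, j}" J ?f] I measurable_centered_mgf[OF assms(1,2)]
    by (simp add: f)
  also have "\<dots> \<le> (\<integral>\<^sup>+ x. ennreal (exp (l\<^sup>2 / 8)) ^ card J \<partial>(\<Pi>\<^sub>M i\<in>{i, j}. M))"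
  proof (rule nn_integral_mono)
    fix x assume "x \<in> space (\<Pi>\<^sub>M i\<in>{i, j}. M)"
    then have x: "x i \<in> space M" "x j \<in> space M"
      by (auto simp: space_PiM)
    have [measurable]: "W (x i) \<in> borel_measurable M" "W (x j) \<in> borel_measurable M"
      using x by auto
    have "(\<integral>\<^sup>+ y. ?f (merge {i, j} J (x, y)) \<partial>(\<Pi>\<^sub>M i\<in>J. M))
        = (\<integral>\<^sup>+ y. (\<Prod>k\<in>J. ?h (x i) (x j) (y k)) \<partial>(\<Pi>\<^sub>M i\<in>J. M))"
      by (intro nn_integral_cong prod.cong refl) (auto simp: merge_def J_def)
    also have "\<dots> = (\<Prod>k\<in>J. \<integral>\<^sup>+ z. ?h (x i) (x j) z \<partial>M)"
      using I(3) by (rule product_nn_integral_prod) measurable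
    also have "\<dots> \<le> (\<Prod>k\<in>J. ennreal (exp (l\<^sup>2 / 8)))"
      by (intro prod_mono_ennreal h x)
    finally show "(\<integral>\<^sup>+ y. ?f (merge {i, j} J (x, y)) \<partial>(\<Pi>\<^sub>M i\<in>J. M)) \<le> ennreal (exp (l\<^sup>2 / 8)) ^ card J"
      by simp
  qed
  also have "\<dots> = ennreal (exp (l\<^sup>2 / 8)) ^ card J"
    by (simp add: prob_space.emeasure_space_1[OF prob_space_PiM] prob_space_axioms)
  also have "\<dots> = ennreal (exp (real (card J) * (l\<^sup>2 / 8)))"
    by (simp add: ennreal_power flip: exp_of_nat_mult)
  also have "card J = n - 2"
    using assms by (simp add: J_def card_Diff_subset)
  finally show ?thesis by (simp add: f)
qed

text \<open>Chernoff's bound under the conditional law. A positive \<open>l\<close> gives the upper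
  tail and a negative \<open>l\<close> the lower tail.\<close>

lemma emeasure_cond_graph_tail_le:
  assumes \<omega>: "\<omega> \<in> space (\<Pi>\<^sub>M i\<in>{1..n}. M)" and ij: "i \<in> {1..n}" "j \<in> {1..n}" "i \<noteq> j"
  shows "emeasure (measure_pmf (cond_graph_pmf W n \<omega>))
      {A. a \<le> l * (real n * row_inner n (A i) (A j) - real (n - 2) * nbhd_inner M W (\<omega> i) (\<omega> j))}
    \<le> ennreal (exp (- a)) * centered_mgf M W n l i j \<omega>" (is "emeasure _ ?E \<le> _")
proof -
  define J where "J = {1..n} - {i, j}"
  define c where "c = nbhd_inner M W (\<omega> i) (\<omega> j)"
  define p where "p = (\<lambda>(i, j). bernoulli_pmf (W (\<omega> i) (\<omega> j)))"
  let ?Q = "Pi_pmf (edge_slots n) False p"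
  let ?X = "\<lambda>e. \<Sum>k\<in>J. of_bool (e (slot i k) \<and> e (slot j k)) :: real"
  have card: "card J = n - 2"
    using ij by (simp add: J_def card_Diff_subset)
  have \<omega>_space: "\<omega> k \<in> space M" if "k \<in> {1..n}" for k
    using \<omega> that by (auto simp: space_PiM)
  have pmf_slot: "pmf (p (slot a k)) True = W (\<omega> a) (\<omega> k)"
    if "a \<in> {1..n}" "k \<in> {1..n}" for a k
  proof -
    have "pmf (p (slot a k)) True = W (\<omega> (min a k)) (\<omega> (max a k))"
      using W_range[of "\<omega> (min a k)" "\<omega> (max a k)"] that
      by (simp add: p_def slot_def \<omega>_space min_def max_def)
    also have "\<dots> = W (\<omega> a) (\<omega> k)"
      using W_symmetric[of "\<omega> a" "\<omega> k"] that by (simp add: \<omega>_space min_def max_def)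
    finally show ?thesis .
  qed
  have row: "real n * row_inner n (adj_matrix e i) (adj_matrix e j) = ?X e" for e
    using ij by (simp add: row_inner_adj_matrix J_def)
  have "emeasure (measure_pmf (cond_graph_pmf W n \<omega>)) ?E
      = (\<integral>\<^sup>+ e. indicator (adj_matrix -` ?E) e \<partial>?Q)"
    by (simp add: cond_graph_pmf_def p_def)
  also have "\<dots> \<le> (\<integral>\<^sup>+ e. ennreal (exp (- a - l * (real (n - 2) * c))) * ennreal (exp (l * ?X e)) \<partial>?Q)"
  proof (rule nn_integral_mono)
    fix e
    \<comment> \<open>Markov's inequality in pointwise form: on the event the exponent is
      nonnegative.\<close>
    have "(1::real) \<le> exp (- a - l * (real (n - 2) * c) + l * ?X e)" if "adj_matrix e \<in> ?E"
      using that by (simp add: row c_def algebra_simps)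
    then show "indicator (adj_matrix -` ?E) e
        \<le> ennreal (exp (- a - l * (real (n - 2) * c))) * ennreal (exp (l * ?X e))"
      by (auto simp: indicator_def simp flip: ennreal_mult exp_add)
  qed
  also have "\<dots> = ennreal (exp (- a - l * (real (n - 2) * c))) * (\<integral>\<^sup>+ e. ennreal (exp (l * ?X e)) \<partial>?Q)"
    by (rule nn_integral_cmult) simp
  also have "(\<integral>\<^sup>+ e. ennreal (exp (l * ?X e)) \<partial>?Q)
      = (\<Prod>k\<in>J. ennreal (1 + (exp l - 1) * (pmf (p (slot i k)) True * pmf (p (slot j k)) True)))"
  proof (rule nn_integral_Pi_pmf_exp_conj)
    \<comment> \<open>Different \<open>k\<close> use different edges: a common edge would force
      \<open>k\<close> to be \<open>i\<close> or \<open>j\<close>, which \<open>J\<close>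
      excludes.\<close>
    show "disjoint_family_on (\<lambda>k. {slot i k, slot j k}) J"
      using ij by (auto simp: disjoint_family_on_def slot_eq_iff J_def)
  qed (use ij in \<open>auto simp: J_def finite_edge_slots slot_eq_iff intro!: slot_in_edge_slots\<close>)
  also have "\<dots> = (\<Prod>k\<in>J. ennreal (1 + (exp l - 1) * (W (\<omega> i) (\<omega> k) * W (\<omega> j) (\<omega> k))))"
    using ij by (intro prod.cong refl) (auto simp: pmf_slot J_def)
  also have "ennreal (exp (- a - l * (real (n - 2) * c)))
      = ennreal (exp (- a)) * (\<Prod>k\<in>J. ennreal (exp (- (l * c))))"
    by (simp add: ennreal_power card algebra_simps flip: ennreal_mult exp_add exp_of_nat_mult)
  finally show ?thesis
    by (simp add: centered_mgf_def prod.distrib J_def c_def mult_ac)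
qed

section \<open>Comparison of packings when all inner products are accurate\<close>

text \<open>The deterministic half of the argument. The margin \<open>4 * \<delta>\<close> pays for
  \<open>\<delta>\<close> from each of the two norm terms and \<open>2 * \<delta>\<close> from the
  doubled mixed term.\<close>

lemma not_N_hat_new_greater:
  assumes "\<epsilon> > 0" "0 \<le> \<delta>" and m: "argmin_rule n m"
    and packing: "packing_number (space M) (nbhd_dist M W) \<epsilon> \<le> enat K"
    and \<omega>: "\<And>i. i \<in> {1..n} \<Longrightarrow> \<omega> i \<in> space M"
    and A: "A = adj_matrix e"
    and dev: "\<And>i j. i \<in> {1..n} \<Longrightarrow> j \<in> {1..n} \<Longrightarrow> i \<noteq> j \<Longrightarrow>
      \<bar>row_inner n (A i) (A j) - nbhd_inner M W (\<omega> i) (\<omega> j)\<bar> \<le> \<delta>"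
  shows "\<not> N_hat_new n m A (sqrt (\<epsilon>\<^sup>2 + 4 * \<delta>)) > enat K"
proof
  define c where "c i j = nbhd_inner M W (\<omega> i) (\<omega> j)" for i j
  define g where "g i j = row_inner n (A i) (A j)" for i j
  define q where "q i = (if c i i \<ge> c (m A i) (m A i) then i else m A i)" for i
  have m_in: "m A i \<in> {1..n}" "m A i \<noteq> i" if "i \<in> {1..n}" for i
    using m that unfolding argmin_rule_def is_arg_min_def by (metis DiffD1, metis DiffD2 insertI1)
  have q_cases: "q i = i \<or> q i = m A i" for i
    by (simp add: q_def)
  have q_in: "q i \<in> {1..n}" if "i \<in> {1..n}" for i
    using m_in[OF that] that by (simp add: q_def)
  have g_mate: "g i (m A i) \<le> c (q i) (q i) + \<delta>" if "i \<in> {1..n}" for i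
  proof -
    have "c i (m A i) \<le> max (c i i) (c (m A i) (m A i))"
      unfolding c_def using that m_in by (intro nbhd_inner_le_max \<omega>)
    moreover have "max (c i i) (c (m A i) (m A i)) = c (q i) (q i)"
      by (auto simp: q_def)
    ultimately show ?thesis
      using dev[of i "m A i"] m_in[OF that] that by (simp add: g_def c_def)
  qed
  have g_self: "g i (m A i) \<le> g (q i) (q i)" for i
    using q_cases[of i] row_inner_adj_matrix_le_self by (auto simp: g_def A)
  assume "N_hat_new n m A (sqrt (\<epsilon>\<^sup>2 + 4 * \<delta>)) > enat K"
  then obtain S where S: "finite S" "S \<subseteq> {1..n}" "K < card S"
    and sep: "pairwise (\<lambda>i j. r_new n m A i j > sqrt (\<epsilon>\<^sup>2 + 4 * \<delta>)) S"
    by (auto simp: N_hat_new_def packing_number_def less_SUP_iff)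
  have far: "nbhd_dist M W (\<omega> (q i)) (\<omega> (q j)) > \<epsilon>" if ij: "i \<in> S" "j \<in> S" "i \<noteq> j" for i j
  proof -
    have ij': "i \<in> {1..n}" "j \<in> {1..n}" using ij S by auto
    let ?m = "Max ((\<lambda>(k, l). row_inner n (A k) (A l)) ` ({i, m A i} \<times> {j, m A j}))"
    have "sqrt (\<epsilon>\<^sup>2 + 4 * \<delta>) < sqrt (max 0 (g i (m A i) + g j (m A j) - 2 * ?m))"
      using sep ij by (auto simp: pairwise_def r_new_def g_def)
    then have "\<epsilon>\<^sup>2 + 4 * \<delta> < max 0 (g i (m A i) + g j (m A j) - 2 * ?m)"
      by simp
    \<comment> \<open>A positive threshold rules out that the truncation at 0 is active.\<close>
    moreover have pos: "0 < \<epsilon>\<^sup>2 + 4 * \<delta>"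
      using assms(1,2) by (simp add: add_pos_nonneg)
    \<comment> \<open>The maximum in the estimator runs over all four pairs, so it covers
      \<open>(q i, q j)\<close> although \<open>q\<close> depends on the unknown positions.\<close>
    moreover have "g (q i) (q j) \<le> ?m"
      using q_cases[of i] q_cases[of j] by (intro Max_ge) (auto simp: g_def)
    ultimately have less: "\<epsilon>\<^sup>2 + 4 * \<delta> < g i (m A i) + g j (m A j) - 2 * g (q i) (q j)"
      by linarith
    \<comment> \<open>If \<open>q i = q j\<close>, the estimated squared distance is at most \<open>0\<close>, because a 0-1 row has its
      largest inner product with itself.\<close>
    have "q i \<noteq> q j"
      using less pos g_self[of i] g_self[of j] by auto
    \<comment> \<open>The accuracy bound holds off the diagonal only, hence the need for
      \<open>q i \<noteq> q j\<close>.\<close>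
    then have "\<epsilon>\<^sup>2 < c (q i) (q i) + c (q j) (q j) - 2 * c (q i) (q j)"
      using less g_mate[OF ij'(1)] g_mate[OF ij'(2)] dev[OF q_in q_in, OF ij'] by (simp add: g_def c_def)
    also have "\<dots> = (nbhd_dist M W (\<omega> (q i)) (\<omega> (q j)))\<^sup>2"
      unfolding c_def using ij' by (subst nbhd_dist_squared) (auto intro!: \<omega> q_in simp del: atLeastAtMost_iff)
    finally show ?thesis
      by (rule power2_less_imp_less) (simp add: nbhd_dist_def)
  qed
  have self: "\<not> nbhd_dist M W x x > \<epsilon>" for x
    using assms(1) by (simp add: nbhd_dist_def)
  \<comment> \<open>Two indices with the same image would have images at distance 0, against
    \<open>far\<close>.\<close>
  have inj: "inj_on (\<lambda>i. \<omega> (q i)) S"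
    by (rule inj_onI) (metis far self)
  let ?T = "(\<lambda>i. \<omega> (q i)) ` S"
  have "enat (card ?T) \<le> packing_number (space M) (nbhd_dist M W) \<epsilon>"
    unfolding packing_number_def
  proof (rule SUP_upper, safe)
    show "finite ?T" using S by simp
    show "pairwise (\<lambda>x y. nbhd_dist M W x y > \<epsilon>) ?T"
      using far by (auto simp: pairwise_def)
    fix i assume "i \<in> S"
    then show "\<omega> (q i) \<in> space M" using S by (intro \<omega> q_in) auto
  qed
  from order_trans[OF this packing] S inj show False by (simp add: card_image)
qed

end

section \<open>Choice of constants and union bound over the pairs of nodes\<close>

theorem corollary17:
  fixes M :: "'a measure" and W :: "'a \<Rightarrow> 'a \<Rightarrow> real"
    and n K :: nat and \<epsilon> :: real
    and m :: "(nat \<Rightarrow> nat \<Rightarrow> real) \<Rightarrow> nat \<Rightarrow> nat"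
  assumes "n \<ge> 3" and "\<epsilon> > 0" and "K \<ge> 1"
    and "graphon M W"
    and "argmin_rule n m"
    and "packing_number (space M) (nbhd_dist M W) \<epsilon> \<le> enat K"
  shows "measure (W_random_graph M W n)
           {A. N_hat_new n m A (sqrt (\<epsilon>\<^sup>2 + 12 * sqrt (ln (real n) / real n))) > enat K}
         \<le> 2 / real n"
proof -
  interpret graphon M W by fact
  let ?P = "\<Pi>\<^sub>M i\<in>{1..n}. M"
  interpret P: prob_space ?P
    by (intro prob_space_PiM prob_space_axioms)
  define L where "L = sqrt (ln (real n) / real n)"
  define Bad where "Bad = {A. N_hat_new n m A (sqrt (\<epsilon>\<^sup>2 + 12 * L)) > enat K}"
  \<comment> \<open>With \<open>l = 8 * L\<close> or \<open>l = - 8 * L\<close> and level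
    \<open>12 * ln n = 12 * n * L * L\<close>, avoiding the event bounds the deviation by
    \<open>3 / 2 * n * L\<close> on one side. Chernoff's bound has exponent at most
    \<open>- 12 * ln n + 8 * ln n\<close>, so each event has probability at most
    \<open>1 / n ^ 4\<close>.\<close>
  define E where "E = (\<lambda>(\<omega> :: nat \<Rightarrow> 'a) (i, j) l. {A :: nat \<Rightarrow> nat \<Rightarrow> real. 12 * ln (real n)
      \<le> l * (real n * row_inner n (A i) (A j) - real (n - 2) * nbhd_inner M W (\<omega> i) (\<omega> j))})"
  have n: "real n > 0" "real (n - 2) = real n - 2" using assms(1) by auto
  have ln_ge: "ln (real n) \<ge> 1"
    using assms(1) exp_le by (subst ln_ge_iff) (auto intro: order_trans[of _ 3])
  have L_pos: "L > 0" using ln_ge n by (simp add: L_def)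
  have L_sq: "L * L = ln (real n) / real n"
    using ln_ge n by (simp add: L_def)
  \<comment> \<open>This makes \<open>3 / 2 * n * L\<close> at least 2, enough to absorb the error
    from having \<open>n - 2\<close> summands instead of \<open>n\<close>.\<close>
  have L_ge: "4 / (3 * real n) \<le> L"
  proof (rule power2_le_imp_le)
    have "3 * 1 \<le> real n * ln (real n)" using assms(1) ln_ge by (intro mult_mono) auto
    then show "(4 / (3 * real n))\<^sup>2 \<le> L\<^sup>2"
      using n by (simp add: power2_eq_square L_sq field_simps)
  qed (use L_pos in simp)
  have edge: "i \<in> {1..n}" "j \<in> {1..n}" "i \<noteq> j" if "(i, j) \<in> edge_slots n" for i j
    using that by (auto simp: edge_slots_def)
  have cover: "measure_pmf (cond_graph_pmf W n \<omega>) Bad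
      \<le> (\<Sum>x\<in>edge_slots n. \<Sum>l\<in>{8 * L, - 8 * L}. ennreal (exp (- (12 * ln (real n))))
            * centered_mgf M W n l (fst x) (snd x) \<omega>)" if \<omega>: "\<omega> \<in> space ?P" for \<omega>
  proof -
    let ?\<mu> = "measure_pmf (cond_graph_pmf W n \<omega>)"
    have \<omega>_space: "\<omega> i \<in> space M" if "i \<in> {1..n}" for i
      using \<omega> that by (auto simp: space_PiM)
    have "A \<in> (\<Union>x\<in>edge_slots n. \<Union>l\<in>{8 * L, - 8 * L}. E \<omega> x l)"
      if A: "A = adj_matrix e" "A \<in> Bad" for A e
    proof (rule ccontr)
      assume notin: "A \<notin> (\<Union>x\<in>edge_slots n. \<Union>l\<in>{8 * L, - 8 * L}. E \<omega> x l)"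
      have dev: "\<bar>row_inner n (A i) (A j) - nbhd_inner M W (\<omega> i) (\<omega> j)\<bar> \<le> 3 * L"
        if "(i, j) \<in> edge_slots n" for i j
      proof -
        let ?c = "nbhd_inner M W (\<omega> i) (\<omega> j)" and ?r = "row_inner n (A i) (A j)"
        let ?D = "real n * ?r - real (n - 2) * ?c"
        have "8 * L * ?D < 12 * ln (real n)" "- 8 * L * ?D < 12 * ln (real n)"
          using notin that by (force simp: E_def)+
        moreover have "ln (real n) = real n * (L * L)"
          using n by (simp add: L_sq)
        ultimately have "8 * L * ?D < 8 * L * (3 / 2 * real n * L)" "8 * L * (- ?D) < 8 * L * (3 / 2 * real n * L)"
          by (simp_all add: algebra_simps)
        then have D: "?D < 3 / 2 * real n * L" "- ?D < 3 / 2 * real n * L"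
          using L_pos by (simp_all only: mult_less_cancel_left_pos)
        have c: "0 \<le> ?c" "?c \<le> 1"
          using edge[OF that] by (auto intro!: nbhd_inner_range \<omega>_space simp del: atLeastAtMost_iff)
        have nL: "4 / 3 \<le> real n * L"
          using L_ge n by (simp add: field_simps)
        \<comment> \<open>The bias \<open>2 * ?c\<close> lies between 0 and 2, so it costs at most
          another \<open>3 / 2 * n * L\<close>; the total is \<open>3 * n * L\<close>.\<close>
        have D_eq: "?D = real n * (?r - ?c) + 2 * ?c"
          by (simp add: n algebra_simps)
        have "real n * (?r - ?c) \<le> real n * (3 * L)" "real n * (- (?r - ?c)) \<le> real n * (3 * L)"
          using D c nL unfolding D_eq by (simp_all add: algebra_simps)
        then show ?thesis
          using n by (simp add: abs_le_iff)
      qed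
      \<comment> \<open>Accuracy \<open>\<delta> = 3 * L\<close> gives
        \<open>4 * \<delta> = 12 * L\<close>, the shift in the threshold of the test.\<close>
      have "\<not> N_hat_new n m A (sqrt (\<epsilon>\<^sup>2 + 4 * (3 * L))) > enat K"
      proof (rule not_N_hat_new_greater[where \<omega> = \<omega>])
        fix i j assume ij: "i \<in> {1..n}" "j \<in> {1..n}" "i \<noteq> j"
        show "\<bar>row_inner n (A i) (A j) - nbhd_inner M W (\<omega> i) (\<omega> j)\<bar> \<le> 3 * L"
        proof (cases "i < j")
          case True
          then show ?thesis using ij by (intro dev) (auto simp: edge_slots_def)
        next
          case False
          then have "(j, i) \<in> edge_slots n" using ij by (auto simp: edge_slots_def)
          from dev[OF this] show ?thesis
            by (simp add: row_inner_def nbhd_inner_def mult.commute)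
        qed
      qed (use assms L_pos \<omega>_space A in auto)
      with A show False by (simp add: Bad_def)
    qed
    \<comment> \<open>The inclusion was shown for matrices of the form \<open>adj_matrix e\<close>,
      on which the conditional law is concentrated.\<close>
    then have "emeasure ?\<mu> Bad \<le> emeasure ?\<mu> (\<Union>x\<in>edge_slots n. \<Union>l\<in>{8 * L, - 8 * L}. E \<omega> x l)"
      by (intro emeasure_mono_AE) (auto simp: AE_measure_pmf_iff cond_graph_pmf_def)
    also have "\<dots> \<le> (\<Sum>x\<in>edge_slots n. emeasure ?\<mu> (\<Union>l\<in>{8 * L, - 8 * L}. E \<omega> x l))"
      by (rule emeasure_subadditive_finite) (auto simp: finite_edge_slots)
    also have "\<dots> \<le> (\<Sum>x\<in>edge_slots n. \<Sum>l\<in>{8 * L, - 8 * L}. emeasure ?\<mu> (E \<omega> x l))"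
      by (intro sum_mono emeasure_subadditive_finite) auto
    also have "\<dots> \<le> (\<Sum>x\<in>edge_slots n. \<Sum>l\<in>{8 * L, - 8 * L}.
        ennreal (exp (- (12 * ln (real n)))) * centered_mgf M W n l (fst x) (snd x) \<omega>)"
    proof (intro sum_mono)
      fix x l assume "x \<in> edge_slots n"
      then show "emeasure ?\<mu> (E \<omega> x l)
          \<le> ennreal (exp (- (12 * ln (real n)))) * centered_mgf M W n l (fst x) (snd x) \<omega>"
        using emeasure_cond_graph_tail_le[OF \<omega> edge] by (cases x) (simp add: E_def)
    qed
    finally show ?thesis .
  qed
  have meas [measurable]: "centered_mgf M W n l (fst x) (snd x) \<in> borel_measurable ?P"
    if "x \<in> edge_slots n" for l x
    using that edge[of "fst x" "snd x"] by (intro measurable_centered_mgf) auto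
  have term_le: "ennreal (exp (- (12 * ln (real n)))) * (\<integral>\<^sup>+ \<omega>. centered_mgf M W n l (fst x) (snd x) \<omega> \<partial>?P)
      \<le> ennreal (exp (- 4 * ln (real n)))" if x: "x \<in> edge_slots n" and l: "l \<in> {8 * L, - 8 * L}" for x l
  proof -
    have "l\<^sup>2 = 64 * (ln (real n) / real n)"
      using l by (auto simp: power2_eq_square L_sq)
    then have "real (n - 2) * (l\<^sup>2 / 8) \<le> 8 * ln (real n)"
      using n ln_ge by (simp add: field_simps)
    then have le: "- (12 * ln (real n)) + real (n - 2) * (l\<^sup>2 / 8) \<le> - 4 * ln (real n)"
      by simp
    have "ennreal (exp (- (12 * ln (real n)))) * (\<integral>\<^sup>+ \<omega>. centered_mgf M W n l (fst x) (snd x) \<omega> \<partial>?P)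
        \<le> ennreal (exp (- (12 * ln (real n)))) * ennreal (exp (real (n - 2) * (l\<^sup>2 / 8)))"
      using x edge[of "fst x" "snd x"] by (intro mult_left_mono nn_integral_centered_mgf_le) auto
    also have "\<dots> \<le> ennreal (exp (- 4 * ln (real n)))"
      using le by (simp flip: ennreal_mult exp_add)
    finally show ?thesis .
  qed
  have "emeasure (W_random_graph M W n) Bad
      = (\<integral>\<^sup>+ \<omega>. emeasure (measure_pmf (cond_graph_pmf W n \<omega>)) Bad \<partial>?P)"
    unfolding W_random_graph_def
    by (rule emeasure_bind[OF P.not_empty measurable_cond_graph_pmf]) simp
  also have "\<dots> \<le> (\<integral>\<^sup>+ \<omega>. (\<Sum>x\<in>edge_slots n. \<Sum>l\<in>{8 * L, - 8 * L}. ennreal (exp (- (12 * ln (real n))))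
            * centered_mgf M W n l (fst x) (snd x) \<omega>) \<partial>?P)"
    by (intro nn_integral_mono cover)
  also have "\<dots> = (\<Sum>x\<in>edge_slots n. \<Sum>l\<in>{8 * L, - 8 * L}. ennreal (exp (- (12 * ln (real n))))
            * (\<integral>\<^sup>+ \<omega>. centered_mgf M W n l (fst x) (snd x) \<omega> \<partial>?P))"
    using meas by (subst nn_integral_sum; (intro borel_measurable_sum sum.cong refl)?)
      (auto simp: nn_integral_sum nn_integral_cmult nn_integral_add)
  also have "\<dots> \<le> (\<Sum>x\<in>edge_slots n. \<Sum>l\<in>{8 * L, - 8 * L}. ennreal (exp (- 4 * ln (real n))))"
    by (intro sum_mono term_le)
  \<comment> \<open>The factor 2 counts the two tails; \<open>8 * L\<close> and
    \<open>- 8 * L\<close> differ because \<open>L > 0\<close>.\<close>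
  also have "\<dots> = of_nat (card (edge_slots n)) * (2 * ennreal (exp (- 4 * ln (real n))))"
    using L_pos by (simp add: mult_2)
  also have "\<dots> = ennreal (real (card (edge_slots n)) * (2 * exp (- 4 * ln (real n))))"
    by (simp add: ennreal_mult ennreal_of_nat_eq_real_of_nat)
  also have "\<dots> \<le> ennreal (2 / real n)"
  proof (rule ennreal_leI)
    \<comment> \<open>The crude count \<open>n ^ 2\<close> of pairs suffices against
      \<open>2 / n ^ 4\<close> per pair.\<close>
    have "card (edge_slots n) \<le> card ({1..n} \<times> {1..n})"
      by (rule card_mono) (auto simp: edge_slots_def)
    then have "real (card (edge_slots n)) \<le> real n ^ 2"
      by (simp add: power2_eq_square flip: of_nat_mult)
    moreover have "exp (- 4 * ln (real n)) = 1 / real n ^ 4"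
      using n exp_of_nat_mult[of 4 "ln (real n)"] by (simp add: exp_minus field_simps)
    ultimately have "real (card (edge_slots n)) * (2 * exp (- 4 * ln (real n))) \<le> real n ^ 2 * (2 / real n ^ 4)"
      by (intro mult_mono) auto
    also have "\<dots> = 2 / real n ^ 2"
      using n by (simp add: field_simps flip: power_add)
    also have "\<dots> \<le> 2 / real n"
      using assms(1) n by (intro divide_left_mono self_le_power) auto
    finally show "real (card (edge_slots n)) * (2 * exp (- 4 * ln (real n))) \<le> 2 / real n" .
  qed
  finally have "measure (W_random_graph M W n) Bad \<le> 2 / real n"
    by (simp add: measure_def enn2real_leI)
  then show ?thesis by (simp add: Bad_def L_def)
qed

end
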